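(* Let $K$ be a positive integer, $p_A,p_B\in[0,1]$, $q_A=1-p_A$, $q_B=1-p_B$. For a $(p_A,p_B,K)$ set tie-breaker with player $A$ serving first, the number of points played $N_{ST}$ satisfies, for every positive integer $n$, $$\Pr\{N_{ST}=n\}=\left[\theta_{ST}(K,n-K;p_A,p_B,K)+\theta_{ST}(n-K,K;p_A,p_B,K)\right]I\{K\le n\le 2(K-1)\}$$ $$\qquad+\left[\theta_{ST}(K-1,K-1;p_A,p_B,K)\,\Pr\{N_{STT}=n-(2K-2)\}\right]I\{n\ge 2K;\ n\text{ even}\},$$ with $$\Pr\{N_{STT}=2L\}=(p_Ap_B+q_Aq_B)^{L-1}(p_Aq_B+q_Ap_B)\quad\text{for } L=1,2,\ldots.$$
   Context: Players $A$ and $B$ play points; all point outcomes are independent. When $A$ serves a point, $A$ wins it with probability $p_A$ (and $B$ wins it otherwise); when $B$ serves a point, $B$ wins it with probability $p_B$ (and $A$ wins it otherwise). $K$-point set tie-breaker: $A$ serves first and the serving sequence is $ABBAABBAA\ldots$ ($A$ serves the $n$th point iff $n\bmod 4\in\{0,1\}$). The first player to reach at least $K$ points with an advantage of at least two points wins. If the score becomes $(K-1,K-1)$, the set tie-breaker's tie-breaker (STT) ensues: the same serving sequence is continued, and the first player to be ahead by two points wins. A score $(a,b)$ means $A$ has $a$ points and $B$ has $b$ points. $N_{ST}$ is the total number of points played in the set tie-breaker (including the STT, if reached). $N_{STT}$ is the number of points played in the STT, given that it is reached. Notation: for $0\le h\le K-2$, $\theta_{ST}(K,h;p_A,p_B,K)$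 is the probability that the set tie-breaker ends with score $(K,h)$ ($A$ wins), and $\theta_{ST}(h,K;p_A,p_B,K)$ is the probability that it ends with score $(h,K)$ ($B$ wins). $\theta_{ST}(K-1,K-1;p_A,p_B,K)$ is the probability that the score $(K-1,K-1)$ is reached. $I\{\cdot\}$ is the indicator function. Convention: $0^0=1$. *)

theory Defs
  imports "HOL-Probability.Probability"
begin

definition A_serves :: "nat \<Rightarrow> bool" where
  "A_serves n \<longleftrightarrow> n mod 4 \<in> {0, 1}"

text \<open>
  The points are numbered from 1. The random variable \<open>X n\<close> is true iff player A wins
  the \<open>n\<close>th point; \<open>X 0\<close> plays no role. The sequence of points is infinite, and the durations
  below are stopping times on it.
\<close>

locale tiebreak_points = prob_space M
  for M :: "'w measure" +
  fixes X :: "nat \<Rightarrow> 'w \<Rightarrow> bool" and pA pB :: real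
  assumes indep_points: "indep_vars (\<lambda>_. count_space UNIV) X {1..}"
    and prob_A_serves: "\<And>n. n \<ge> 1 \<Longrightarrow> A_serves n \<Longrightarrow> \<P>(\<omega> in M. X n \<omega>) = pA"
    and prob_B_serves: "\<And>n. n \<ge> 1 \<Longrightarrow> \<not> A_serves n \<Longrightarrow> \<P>(\<omega> in M. \<not> X n \<omega>) = pB"

text \<open>Here \<open>w :: nat \<Rightarrow> bool\<close> is one realization of the outcomes (true: A wins the point).\<close>

definition score_A :: "(nat \<Rightarrow> bool) \<Rightarrow> nat \<Rightarrow> nat" where
  "score_A w n = card {i \<in> {1..n}. w i}"

definition score_B :: "(nat \<Rightarrow> bool) \<Rightarrow> nat \<Rightarrow> nat" where
  "score_B w n = card {i \<in> {1..n}. \<not> w i}"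

definition first_time :: "(nat \<Rightarrow> bool) \<Rightarrow> enat" where
  "first_time P = (if \<exists>n. P n then enat (LEAST n. P n) else \<infinity>)"

definition won_by :: "nat \<Rightarrow> nat \<Rightarrow> nat \<Rightarrow> bool" where
  "won_by K a b \<longleftrightarrow> a \<ge> K \<and> a \<ge> b + 2"

text \<open>
  The same stopping rule covers the set tie-breaker's tie-breaker: from the score \<open>(K-1, K-1)\<close> on,
  an advantage of two points already entails at least \<open>K\<close> points.
\<close>

definition N_ST :: "nat \<Rightarrow> (nat \<Rightarrow> bool) \<Rightarrow> enat" where
  "N_ST K w = first_time (\<lambda>n. won_by K (score_A w n) (score_B w n)
                            \<or> won_by K (score_B w n) (score_A w n))"

definition ends_with :: "nat \<Rightarrow> (nat \<Rightarrow> bool) \<Rightarrow> nat \<Rightarrow> nat \<Rightarrow> bool" where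
  "ends_with K w a b \<longleftrightarrow> (\<exists>n. N_ST K w = enat n \<and> score_A w n = a \<and> score_B w n = b)"

definition reaches :: "nat \<Rightarrow> (nat \<Rightarrow> bool) \<Rightarrow> nat \<Rightarrow> nat \<Rightarrow> bool" where
  "reaches K w a b \<longleftrightarrow> (\<exists>n. enat n \<le> N_ST K w \<and> score_A w n = a \<and> score_B w n = b)"

text \<open>The STT is played on the points after point \<open>2K-2\<close>, with the score restarted at \<open>(0,0)\<close>.\<close>

definition N_STT :: "nat \<Rightarrow> (nat \<Rightarrow> bool) \<Rightarrow> enat" where
  "N_STT K w = (let v = (\<lambda>i. w (2 * (K - 1) + i)) in
     first_time (\<lambda>m. score_A v m \<ge> score_B v m + 2 \<or> score_B v m \<ge> score_A v m + 2))"

text \<open>\<open>theta_ST M X K a b\<close> is used for the scores \<open>(K, h)\<close> and \<open>(h, K)\<close> with \<open>h + 2 \<le> K\<close>, and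
  \<open>theta_tied M X K\<close> for the score \<open>(K-1, K-1)\<close>, at which the play does not end.\<close>

definition theta_ST ::
  "'w measure \<Rightarrow> (nat \<Rightarrow> 'w \<Rightarrow> bool) \<Rightarrow> nat \<Rightarrow> nat \<Rightarrow> nat \<Rightarrow> real" where
  "theta_ST M X K a b = \<P>(\<omega> in M. ends_with K (\<lambda>i. X i \<omega>) a b)"

definition theta_tied :: "'w measure \<Rightarrow> (nat \<Rightarrow> 'w \<Rightarrow> bool) \<Rightarrow> nat \<Rightarrow> real" where
  "theta_tied M X K = \<P>(\<omega> in M. reaches K (\<lambda>i. X i \<omega>) (K - 1) (K - 1))"

text \<open>
  The law of the duration of the STT is conditional on \<open>(K-1, K-1)\<close> being reached. If this has
  probability 0 (e.g. \<open>K = 2\<close>, \<open>pA = 1\<close>, \<open>pB = 0\<close>), the elementary conditional probability is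
  undefined, and the law is that of an STT played on the points after point \<open>2K-2\<close>.
\<close>

definition prob_N_STT :: "'w measure \<Rightarrow> (nat \<Rightarrow> 'w \<Rightarrow> bool) \<Rightarrow> nat \<Rightarrow> nat \<Rightarrow> real" where
  "prob_N_STT M X K m =
     (if theta_tied M X K \<noteq> 0
      then \<P>(\<omega> in M. N_STT K (\<lambda>i. X i \<omega>) = enat m \<bar> reaches K (\<lambda>i. X i \<omega>) (K - 1) (K - 1))
      else \<P>(\<omega> in M. N_STT K (\<lambda>i. X i \<omega>) = enat m))"

end

theory Submission
  imports Defs
begin

text \<open>
  Up to point \<open>2K-2\<close> the tie-breaker can only end with the winner at exactly \<open>K\<close> points: a larger
  winning score needs a two-point lead that was held, with at least \<open>K\<close> points, one point earlier,
  or else at least \<open>2K\<close> points in all. The length \<open>n\<close> then determines the loser's score \<open>n-K < K\<close>,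
  so the event is the disjoint union of the two final scores (\<open>N_ST_early_iff\<close>).

  A play that is still undecided after \<open>2K-2\<close> points is level at \<open>(K-1, K-1)\<close>, and conversely a
  level score there means that nobody had reached \<open>K\<close> before. From a level score on, the stopping
  rule depends only on the lead gained since, so the total length is \<open>2K-2\<close> plus the length of the
  STT, pathwise (\<open>N_ST_late_iff\<close>).

  The STT splits into consecutive pairs of points. It continues through a pair iff the two points
  have different winners, which restores the level score, and it ends with the first pair that one
  player sweeps (\<open>first_two_ahead_iff_pairs\<close>). Its length is therefore even. The \<open>2K-2\<close> points before it
  are an even number, so each pair contains one serve of each player, and by independence a pair is
  split with probability \<open>pA pB + qA qB\<close> and swept with probability \<open>pA qB + qA pB\<close>, whoever serves
  first in it and whatever happened before (\<open>prob_determined_and_next_pair\<close>). This gives the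
  geometric law, and it gives it both unconditionally and conditionally on the STT being
  reached, since that event is determined by the first \<open>2K-2\<close> points.
\<close>

section \<open>Scores and first times\<close>

lemma score_0 [simp]: "score_A w 0 = 0" "score_B w 0 = 0"
  by (simp_all add: score_A_def score_B_def)

lemma score_A_Suc: "score_A w (Suc n) = score_A w n + of_bool (w (Suc n))"
proof -
  have "{i \<in> {1..Suc n}. w i} = {i \<in> {1..n}. w i} \<union> (if w (Suc n) then {Suc n} else {})"
    by (auto simp: le_Suc_eq)
  then show ?thesis by (auto simp: score_A_def)
qed

lemma score_B_eq_score_A: "score_B w n = score_A (\<lambda>i. \<not> w i) n"
  by (simp add: score_A_def score_B_def)

lemma score_B_Suc: "score_B w (Suc n) = score_B w n + of_bool (\<not> w (Suc n))"
  by (simp add: score_B_eq_score_A score_A_Suc)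

lemmas score_Suc = score_A_Suc score_B_Suc

lemma score_add: "score_A w n + score_B w n = n"
  by (induction n) (auto simp: score_Suc)

lemma score_mono:
  assumes "m \<le> n"
  shows "score_A w m \<le> score_A w n" "score_B w m \<le> score_B w n"
  using assms by (induction rule: dec_induct) (auto simp: score_Suc)

lemma score_shift:
  "score_A w (N + m) = score_A w N + score_A (\<lambda>i. w (N + i)) m"
  "score_B w (N + m) = score_B w N + score_B (\<lambda>i. w (N + i)) m"
  by (induction m) (auto simp: score_Suc)

lemma score_cong:
  assumes "\<forall>i\<in>{1..n}. v i = w i"
  shows "score_A v n = score_A w n" "score_B v n = score_B w n"
  using assms by (auto simp: score_A_def score_B_def intro!: arg_cong[where f = card])

lemma first_time_eq_enat_iff: "first_time P = enat n \<longleftrightarrow> P n \<and> (\<forall>m<n. \<not> P m)"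
proof
  assume "first_time P = enat n"
  then have "\<exists>n. P n" "n = (LEAST n. P n)"
    by (auto simp: first_time_def split: if_splits)
  then show "P n \<and> (\<forall>m<n. \<not> P m)"
    using LeastI_ex not_less_Least by metis
next
  assume "P n \<and> (\<forall>m<n. \<not> P m)"
  moreover from this have "(LEAST n. P n) = n"
    by (intro Least_equality) (auto simp: not_less[symmetric])
  ultimately show "first_time P = enat n"
    by (auto simp: first_time_def)
qed

lemma enat_le_first_time_iff: "enat n \<le> first_time P \<longleftrightarrow> (\<forall>m<n. \<not> P m)"
proof
  assume "enat n \<le> first_time P"
  then show "\<forall>m<n. \<not> P m"
    by (auto simp: first_time_def split: if_splits dest!: not_less_Least dest: less_le_trans)
next
  assume none: "\<forall>m<n. \<not> P m"
  show "enat n \<le> first_time P"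
    using none LeastI_ex[of P] by (auto simp: first_time_def not_less[symmetric])
qed

section \<open>The duration of the tie-breaker's tie-breaker\<close>

definition two_ahead :: "(nat \<Rightarrow> bool) \<Rightarrow> nat \<Rightarrow> bool" where
  "two_ahead v m \<longleftrightarrow> score_A v m \<ge> score_B v m + 2 \<or> score_B v m \<ge> score_A v m + 2"

lemma level_if_pairs_split:
  assumes "\<forall>j<L. v (2*j+1) \<noteq> v (2*j+2)"
  shows "score_A v (2*L) = score_B v (2*L)"
  using assms by (induction L) (auto simp: score_Suc)

text \<open>
  The lead is odd after an odd number of points. While it has stayed below two it is thus \<open>0\<close>
  after each complete pair, and the next pair makes it \<open>0\<close> again or \<open>2\<close>.
\<close>

lemma not_two_ahead_iff_pairs_split:
  "(\<forall>m\<le>2*L. \<not> two_ahead v m) \<longleftrightarrow> (\<forall>j<L. v (2*j+1) \<noteq> v (2*j+2))"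
proof (induction L)
  case 0
  show ?case by (simp add: two_ahead_def)
next
  case (Suc L)
  have "(\<forall>m\<le>2*Suc L. \<not> two_ahead v m) \<longleftrightarrow>
      (\<forall>m\<le>2*L. \<not> two_ahead v m) \<and> \<not> two_ahead v (Suc (2*L)) \<and> \<not> two_ahead v (Suc (Suc (2*L)))"
    by (auto simp: le_Suc_eq)
  moreover have "\<not> two_ahead v (Suc (2*L))" "two_ahead v (Suc (Suc (2*L))) \<longleftrightarrow> v (2*L+1) = v (2*L+2)"
    if "\<forall>j<L. v (2*j+1) \<noteq> v (2*j+2)"
    using level_if_pairs_split[OF that] by (auto simp: two_ahead_def score_Suc)
  ultimately show ?case
    unfolding Suc.IH by (auto simp: less_Suc_eq)
qed

lemma first_two_ahead_iff_pairs:
  assumes "L \<ge> 1"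
  shows "first_time (two_ahead v) = enat (2*L) \<longleftrightarrow>
    (\<forall>j<L-1. v (2*j+1) \<noteq> v (2*j+2)) \<and> v (2*(L-1)+1) = v (2*(L-1)+2)"
proof -
  obtain l where L: "L = Suc l" using assms by (cases L) auto
  have "(\<forall>m<2*L. \<not> two_ahead v m) \<longleftrightarrow> (\<forall>m\<le>2*l. \<not> two_ahead v m) \<and> \<not> two_ahead v (Suc (2*l))"
    by (auto simp: L less_Suc_eq le_less)
  moreover have "\<not> two_ahead v (Suc (2*l))" "two_ahead v (2*L) \<longleftrightarrow> v (2*l+1) = v (2*l+2)"
    if "\<forall>j<l. v (2*j+1) \<noteq> v (2*j+2)"
    using level_if_pairs_split[OF that] by (auto simp: L two_ahead_def score_Suc)
  ultimately show ?thesis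
    unfolding first_time_eq_enat_iff not_two_ahead_iff_pairs_split by (auto simp: L)
qed

lemma first_two_ahead_even:
  assumes "first_time (two_ahead v) = enat m"
  shows "even m"
proof (rule ccontr)
  assume "odd m"
  then obtain l where m: "m = Suc (2*l)" by (auto elim: oddE)
  have "\<forall>m\<le>2*l. \<not> two_ahead v m" "two_ahead v (Suc (2*l))"
    using assms by (auto simp: first_time_eq_enat_iff m)
  then show False
    using level_if_pairs_split[of l v]
    unfolding not_two_ahead_iff_pairs_split by (cases "v (Suc (2*l))") (auto simp: two_ahead_def score_Suc)
qed

lemma N_STT_eq: "N_STT K w = first_time (two_ahead (\<lambda>i. w (2*(K-1) + i)))"
  by (simp add: N_STT_def two_ahead_def[abs_def] Let_def)

section \<open>The stages of the set tie-breaker\<close>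

definition over :: "nat \<Rightarrow> (nat \<Rightarrow> bool) \<Rightarrow> nat \<Rightarrow> bool" where
  "over K w n \<longleftrightarrow> won_by K (score_A w n) (score_B w n) \<or> won_by K (score_B w n) (score_A w n)"

lemma N_ST_eq: "N_ST K w = first_time (over K w)"
  by (simp add: N_ST_def over_def[abs_def])

text \<open>
  With \<open>2K-2\<close> points played, a player has at least \<open>K\<close> iff the other has at most \<open>K-2\<close>, so the
  play is undecided at that moment only at a level score. Scores never decrease, so a level score
  \<open>K-1\<close> also excludes an earlier end.
\<close>

lemma not_over_iff_level:
  assumes "K \<ge> 1"
  shows "(\<forall>m\<le>2*(K-1). \<not> over K w m) \<longleftrightarrow> score_A w (2*(K-1)) = K-1"
proof
  assume "\<forall>m\<le>2*(K-1). \<not> over K w m"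
  then have "\<not> over K w (2*(K-1))" by simp
  then show "score_A w (2*(K-1)) = K-1"
    using score_add[of w "2*(K-1)"] assms by (auto simp: over_def won_by_def)
next
  assume level: "score_A w (2*(K-1)) = K-1"
  show "\<forall>m\<le>2*(K-1). \<not> over K w m"
  proof (intro allI impI)
    fix m assume "m \<le> 2*(K-1)"
    from score_mono[OF this, of w] level show "\<not> over K w m"
      using score_add[of w "2*(K-1)"] assms by (auto simp: over_def won_by_def)
  qed
qed

text \<open>
  Reaching \<open>(K-1, K-1)\<close> becomes a condition on the first \<open>2K-2\<close> points alone, without the
  stopping time.
\<close>

lemma reaches_level_iff:
  assumes "K \<ge> 1"
  shows "reaches K w (K-1) (K-1) \<longleftrightarrow> score_A w (2*(K-1)) = K-1"
proof
  assume "reaches K w (K-1) (K-1)"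
  then obtain n where "score_A w n = K-1" "score_B w n = K-1"
    by (auto simp: reaches_def)
  moreover from this score_add[of w n] have "n = 2*(K-1)" by simp
  ultimately show "score_A w (2*(K-1)) = K-1" by simp
next
  assume level: "score_A w (2*(K-1)) = K-1"
  then have "score_B w (2*(K-1)) = K-1"
    using score_add[of w "2*(K-1)"] by simp
  moreover have "enat (2*(K-1)) \<le> N_ST K w"
    using level not_over_iff_level[OF assms, of w] by (auto simp: N_ST_eq enat_le_first_time_iff)
  ultimately show "reaches K w (K-1) (K-1)"
    using level by (auto simp: reaches_def)
qed

text \<open>
  After a level score \<open>K-1\<close>, a lead of two already implies at least \<open>K\<close> points, so both stopping
  rules agree from there on.
\<close>

lemma N_ST_late_iff:
  assumes "K \<ge> 1" "n > 2*(K-1)"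
  shows "N_ST K w = enat n \<longleftrightarrow> reaches K w (K-1) (K-1) \<and> N_STT K w = enat (n - 2*(K-1))"
proof (cases "score_A w (2*(K-1)) = K-1")
  case False
  then obtain m where "m \<le> 2*(K-1)" "over K w m"
    using not_over_iff_level[OF assms(1), of w] by auto
  then have "N_ST K w \<noteq> enat n"
    using assms(2) le_less_trans by (auto simp: N_ST_eq first_time_eq_enat_iff)
  then show ?thesis using False reaches_level_iff[OF assms(1), of w] by simp
next
  case True
  define N where "N = 2*(K-1)"
  define v where "v = (\<lambda>i. w (N + i))"
  obtain k where n: "n = N + k" using assms(2) by (metis N_def less_imp_add_positive)
  have none: "\<not> over K w m" if "m \<le> N" for m
    using True not_over_iff_level[OF assms(1), of w] that by (auto simp: N_def)
  have level: "score_A w N = K-1" "score_B w N = K-1"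
    using True score_add[of w N] by (auto simp: N_def)
  have shift: "over K w (N + m) \<longleftrightarrow> two_ahead v m" for m
    using assms(1) by (auto simp: over_def won_by_def two_ahead_def score_shift level v_def)
  have "(\<forall>m<n. \<not> over K w m) \<longleftrightarrow> (\<forall>m<k. \<not> two_ahead v m)"
  proof
    assume "\<forall>m<n. \<not> over K w m"
    then show "\<forall>m<k. \<not> two_ahead v m" by (auto simp: n shift[symmetric])
  next
    assume *: "\<forall>m<k. \<not> two_ahead v m"
    show "\<forall>m<n. \<not> over K w m"
    proof (intro allI impI)
      fix m assume "m < n"
      show "\<not> over K w m"
      proof (cases "m \<le> N")
        case True
        then show ?thesis by (rule none)
      next
        case False
        then obtain i where "m = N + i" by (metis le_Suc_ex nat_le_linear)
        with \<open>m < n\<close> * show ?thesis by (simp add: n shift)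
      qed
    qed
  qed
  then have "N_ST K w = enat n \<longleftrightarrow> first_time (two_ahead v) = enat k"
    by (simp add: N_ST_eq first_time_eq_enat_iff n shift)
  then show ?thesis
    using True reaches_level_iff[OF assms(1), of w]
    by (simp add: N_STT_eq n v_def N_def)
qed

text \<open>
  The winner takes the last point. The play was undecided before it, so either that point brings
  the winner to \<open>K\<close>, or it brings the lead to exactly two with more than \<open>K\<close> points; the latter
  needs at least \<open>2K\<close> points in all.
\<close>

lemma N_ST_early_score:
  assumes "K \<ge> 1" "n \<le> 2*(K-1)" "N_ST K w = enat n"
  shows "score_A w n = K \<or> score_B w n = K"
proof -
  have over: "over K w n" "\<forall>m<n. \<not> over K w m"
    using assms(3) by (auto simp: N_ST_eq first_time_eq_enat_iff)
  have "n \<noteq> 0" using over(1) by (auto simp: over_def won_by_def intro: ccontr)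
  then obtain m where n: "n = Suc m" by (cases n) auto
  have "\<not> over K w m" using over(2) n by simp
  with over(1) show ?thesis
    using assms(1,2) score_add[of w n] unfolding n
    by (cases "w (Suc m)") (auto simp: over_def won_by_def score_Suc)
qed

lemma N_ST_early_iff:
  assumes "K \<ge> 1" "n \<le> 2*(K-1)"
  shows "N_ST K w = enat n \<longleftrightarrow>
    K \<le> n \<and> (ends_with K w K (n-K) \<or> ends_with K w (n-K) K)"
proof
  assume *: "N_ST K w = enat n"
  from N_ST_early_score[OF assms this] score_add[of w n] 
  have "K \<le> n" "score_A w n = K \<and> score_B w n = n-K \<or> score_A w n = n-K \<and> score_B w n = K"
    by auto
  with * show "K \<le> n \<and> (ends_with K w K (n-K) \<or> ends_with K w (n-K) K)"
    by (auto simp: ends_with_def)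
next
  assume *: "K \<le> n \<and> (ends_with K w K (n-K) \<or> ends_with K w (n-K) K)"
  then obtain m where "N_ST K w = enat m" "score_A w m + score_B w m = n"
    by (auto simp: ends_with_def)
  then show "N_ST K w = enat n" by (simp add: score_add)
qed

section \<open>Independence of successive points\<close>

text \<open>
  This expresses membership of an event in the \<open>\<sigma>\<close>-algebra of the first \<open>n\<close> points on single
  realizations. For finitely many Boolean coordinates measurability is then automatic.
\<close>

definition determined_by_first :: "nat \<Rightarrow> ((nat \<Rightarrow> bool) \<Rightarrow> bool) \<Rightarrow> bool" where
  "determined_by_first n Q \<longleftrightarrow> (\<forall>v w. (\<forall>i\<in>{1..n}. v i = w i) \<longrightarrow> Q v = Q w)"

lemma determined_by_firstD:
  "determined_by_first n Q \<Longrightarrow> (\<And>i. i \<in> {1..n} \<Longrightarrow> v i = w i) \<Longrightarrow> Q v = Q w"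
  by (auto simp: determined_by_first_def)

lemma determined_by_first_mono:
  "determined_by_first m Q \<Longrightarrow> m \<le> n \<Longrightarrow> determined_by_first n Q"
  by (fastforce simp: determined_by_first_def)

lemma determined_by_first_conj:
  "determined_by_first n P \<Longrightarrow> determined_by_first n Q \<Longrightarrow> determined_by_first n (\<lambda>w. P w \<and> Q w)"
  unfolding determined_by_first_def by metis

lemma determined_by_first_N_ST: "determined_by_first n (\<lambda>w. N_ST K w = enat n \<and> R (score_A w n) (score_B w n))"
  unfolding determined_by_first_def
proof (intro allI impI)
  fix v w :: "nat \<Rightarrow> bool" assume *: "\<forall>i\<in>{1..n}. v i = w i"
  have "score_A v m = score_A w m" "score_B v m = score_B w m" if "m \<le> n" for m
    using * that by (auto intro!: score_cong)
  then show "(N_ST K v = enat n \<and> R (score_A v n) (score_B v n)) =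
      (N_ST K w = enat n \<and> R (score_A w n) (score_B w n))"
    by (auto simp: N_ST_eq first_time_eq_enat_iff over_def)
qed

lemma determined_by_first_reaches:
  assumes "K \<ge> 1"
  shows "determined_by_first (2*(K-1)) (\<lambda>w. reaches K w (K-1) (K-1))"
  unfolding determined_by_first_def reaches_level_iff[OF assms] by (metis score_cong(1))

context tiebreak_points
begin

text \<open>
  The event becomes the preimage of a set of finite sequences, the form in which independence of
  families of random variables can be applied.
\<close>

lemma determined_event_restrict:
  assumes "determined_by_first n Q"
  shows "{\<omega> \<in> space M. Q (\<lambda>i. X i \<omega>)} =
    (\<lambda>\<omega>. restrict (\<lambda>i. X i \<omega>) {1..n}) -` {v \<in> {1..n} \<rightarrow>\<^sub>E UNIV. Q v} \<inter> space M"
  using determined_by_firstD[OF assms, of "restrict w {1..n}" w for w] by auto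

lemma measurable_point: "i \<ge> 1 \<Longrightarrow> X i \<in> measurable M (count_space UNIV)"
  using indep_points by (auto simp: indep_vars_def)

text \<open>
  The product of finitely many copies of the discrete space \<open>bool\<close> is discrete.
\<close>

lemma sets_PiM_bool: 
  "finite I \<Longrightarrow> S \<subseteq> I \<rightarrow>\<^sub>E UNIV \<Longrightarrow> S \<in> sets (Pi\<^sub>M I (\<lambda>_. count_space (UNIV :: bool set)))"
  by (subst count_space_PiM_finite) auto

lemma sets_determined_event:
  assumes "determined_by_first n Q"
  shows "{\<omega> \<in> space M. Q (\<lambda>i. X i \<omega>)} \<in> events"
  unfolding determined_event_restrict[OF assms]
  by (intro measurable_sets[where A = "Pi\<^sub>M {1..n} (\<lambda>_. count_space UNIV)"] 
      measurable_restrict measurable_point sets_PiM_bool) auto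

lemma prob_determined_and_next_point:
  assumes "determined_by_first n Q"
  shows "\<P>(\<omega> in M. Q (\<lambda>i. X i \<omega>) \<and> X (Suc n) \<omega> = b) =
    \<P>(\<omega> in M. Q (\<lambda>i. X i \<omega>)) * \<P>(\<omega> in M. X (Suc n) \<omega> = b)"
proof -
  let ?past = "\<lambda>\<omega>. restrict (\<lambda>i. X i \<omega>) {1..n}" and ?next = "\<lambda>\<omega>. restrict (\<lambda>i. X i \<omega>) {Suc n}"
  let ?S = "{v \<in> {1..n} \<rightarrow>\<^sub>E UNIV. Q v}" and ?T = "{v \<in> {Suc n} \<rightarrow>\<^sub>E UNIV. v (Suc n) = b}"
  have indep: "indep_var (Pi\<^sub>M {1..n} (\<lambda>_. count_space UNIV)) ?past
                  (Pi\<^sub>M {Suc n} (\<lambda>_. count_space UNIV)) ?next"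
    by (rule indep_var_restrict[OF indep_points]) auto
  have next_event: "{\<omega> \<in> space M. X (Suc n) \<omega> = b} = ?next -` ?T \<inter> space M"
    by auto
  have "{\<omega> \<in> space M. Q (\<lambda>i. X i \<omega>) \<and> X (Suc n) \<omega> = b} =
      {\<omega> \<in> space M. Q (\<lambda>i. X i \<omega>)} \<inter> {\<omega> \<in> space M. X (Suc n) \<omega> = b}"
    by auto
  also have "\<dots> = (\<lambda>\<omega>. (?past \<omega>, ?next \<omega>)) -` (?S \<times> ?T) \<inter> space M"
    unfolding determined_event_restrict[OF assms] next_event by auto
  finally show ?thesis
    using indep_varD[OF indep, of ?S ?T]
    by (simp add: sets_PiM_bool determined_event_restrict[OF assms] next_event)
qed

lemma prob_determined_split:
  assumes "determined_by_first n Q" "determined_by_first n R"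
  shows "\<P>(\<omega> in M. Q (\<lambda>i. X i \<omega>)) =
    \<P>(\<omega> in M. Q (\<lambda>i. X i \<omega>) \<and> R (\<lambda>i. X i \<omega>)) + \<P>(\<omega> in M. Q (\<lambda>i. X i \<omega>) \<and> \<not> R (\<lambda>i. X i \<omega>))"
proof -
  have "determined_by_first n (\<lambda>w. \<not> R w)"
    using assms(2) by (auto simp: determined_by_first_def)
  note meas = determined_by_first_conj[OF assms, THEN sets_determined_event]
    determined_by_first_conj[OF assms(1) this, THEN sets_determined_event]
  show ?thesis
    by (subst finite_measure_Union[symmetric]) (auto intro!: meas arg_cong[where f = prob])
qed

text \<open>The probability that point \<open>n\<close> has the outcome \<open>b\<close>: the server wins it iff \<open>A_serves n = b\<close>.\<close>

definition point_prob :: "nat \<Rightarrow> bool \<Rightarrow> real" where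
  "point_prob n b = (if A_serves n = b then (if b then pA else pB) else (if b then 1 - pB else 1 - pA))"

lemma prob_point:
  assumes "n \<ge> 1"
  shows "\<P>(\<omega> in M. X n \<omega> = b) = point_prob n b"
proof -
  have sum: "\<P>(\<omega> in M. X n \<omega>) + \<P>(\<omega> in M. \<not> X n \<omega>) = 1"
    using prob_determined_split[of n "\<lambda>_. True" "\<lambda>w. w n"] assms
    by (simp add: determined_by_first_def prob_space)
  then show ?thesis
    using prob_A_serves[OF assms] prob_B_serves[OF assms]
    by (cases b; cases "A_serves n") (auto simp: point_prob_def)
qed

lemma prob_determined_and_next_two:
  assumes "determined_by_first n Q"
  shows "\<P>(\<omega> in M. Q (\<lambda>i. X i \<omega>) \<and> X (n+1) \<omega> = b \<and> X (n+2) \<omega> = c) =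
    \<P>(\<omega> in M. Q (\<lambda>i. X i \<omega>)) * (point_prob (n+1) b * point_prob (n+2) c)"
proof -
  have "determined_by_first (Suc n) (\<lambda>w. Q w \<and> w (Suc n) = b)"
    by (intro determined_by_first_conj determined_by_first_mono[OF assms])
       (auto simp: determined_by_first_def)
  from prob_determined_and_next_point[OF this, of c] prob_determined_and_next_point[OF assms, of b]
  show ?thesis by (simp add: prob_point conj_assoc mult.assoc)
qed

text \<open>
  In \<open>ABBAABBA...\<close> the two serves of a player that follow each other are points \<open>2j\<close> and
  \<open>2j+1\<close>, so they lie in different pairs.
\<close>

lemma one_serve_each_per_pair: "even n \<Longrightarrow> A_serves (n+1) \<longleftrightarrow> \<not> A_serves (n+2)"
  unfolding A_serves_def by auto presburger+

text \<open>
  The order of the two serves may vary from pair to pair, but both probabilities are symmetric in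
  it.
\<close>

lemma prob_determined_and_next_pair:
  assumes "determined_by_first n Q" "even n"
  shows "\<P>(\<omega> in M. Q (\<lambda>i. X i \<omega>) \<and> X (n+1) \<omega> \<noteq> X (n+2) \<omega>) =
      \<P>(\<omega> in M. Q (\<lambda>i. X i \<omega>)) * (pA * pB + (1-pA) * (1-pB))" (is ?split)
    and "\<P>(\<omega> in M. Q (\<lambda>i. X i \<omega>) \<and> X (n+1) \<omega> = X (n+2) \<omega>) =
      \<P>(\<omega> in M. Q (\<lambda>i. X i \<omega>)) * (pA * (1-pB) + (1-pA) * pB)" (is ?same)
proof -
  have Q: "determined_by_first (n+2) (\<lambda>w. Q w \<and> (w (n+1) = w (n+2)) = e)" for e
    by (intro determined_by_first_conj determined_by_first_mono[OF assms(1)])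
       (auto simp: determined_by_first_def)
  have first: "determined_by_first (n+2) (\<lambda>w. w (n+1))"
    by (auto simp: determined_by_first_def)
  have cases: "\<P>(\<omega> in M. Q (\<lambda>i. X i \<omega>) \<and> (X (n+1) \<omega> = X (n+2) \<omega>) = e) =
     \<P>(\<omega> in M. Q (\<lambda>i. X i \<omega>) \<and> X (n+1) \<omega> = True \<and> X (n+2) \<omega> = e)
     + \<P>(\<omega> in M. Q (\<lambda>i. X i \<omega>) \<and> X (n+1) \<omega> = False \<and> X (n+2) \<omega> = (\<not> e))" for e
    unfolding prob_determined_split[OF Q first]
    by (intro arg_cong2[where f = "(+)"] arg_cong[where f = prob]) auto
  show ?split ?same
    using cases[of False] cases[of True] one_serve_each_per_pair[OF assms(2)]
    unfolding prob_determined_and_next_two[OF assms(1)]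
    by (auto simp: point_prob_def algebra_simps)
qed

lemma prob_determined_and_pairs_split:
  assumes "determined_by_first n Q" "even n"
  shows "\<P>(\<omega> in M. Q (\<lambda>i. X i \<omega>) \<and> (\<forall>j<L. X (n+2*j+1) \<omega> \<noteq> X (n+2*j+2) \<omega>)) =
      \<P>(\<omega> in M. Q (\<lambda>i. X i \<omega>)) * (pA * pB + (1-pA) * (1-pB)) ^ L"
proof (induction L)
  case (Suc L)
  have "determined_by_first (n+2*L) (\<lambda>w. Q w \<and> (\<forall>j<L. w (n+2*j+1) \<noteq> w (n+2*j+2)))"
    by (intro determined_by_first_conj determined_by_first_mono[OF assms(1)])
       (auto simp: determined_by_first_def)
  from prob_determined_and_next_pair(1)[OF this] assms(2) Suc.IH
  have split_Suc: "\<P>(\<omega> in M. (Q (\<lambda>i. X i \<omega>) \<and> (\<forall>j<L. X (n+2*j+1) \<omega> \<noteq> X (n+2*j+2) \<omega>))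
        \<and> X (n+2*L+1) \<omega> \<noteq> X (n+2*L+2) \<omega>) =
      \<P>(\<omega> in M. Q (\<lambda>i. X i \<omega>)) * (pA * pB + (1-pA) * (1-pB)) ^ Suc L"
    by simp
  have "(q \<and> (\<forall>j<L. P j)) \<and> P L \<longleftrightarrow> q \<and> (\<forall>j<Suc L. P j)" for q P
    by (auto simp: less_Suc_eq)
  from this[of _ "\<lambda>j. X (n+2*j+1) \<omega> \<noteq> X (n+2*j+2) \<omega>" for \<omega>]
  show ?case using split_Suc by simp
qed simp

lemma prob_determined_and_N_STT:
  assumes "determined_by_first (2*(K-1)) Q" "L \<ge> 1"
  shows "\<P>(\<omega> in M. Q (\<lambda>i. X i \<omega>) \<and> N_STT K (\<lambda>i. X i \<omega>) = enat (2*L)) =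
      \<P>(\<omega> in M. Q (\<lambda>i. X i \<omega>))
        * ((pA * pB + (1-pA) * (1-pB)) ^ (L-1) * (pA * (1-pB) + (1-pA) * pB))"
proof -
  define N where "N = 2*(K-1)"
  have "even N" and Q: "determined_by_first N Q" using assms(1) by (auto simp: N_def)
  have split: "determined_by_first (N+2*(L-1)) (\<lambda>w. Q w \<and> (\<forall>j<L-1. w (N+2*j+1) \<noteq> w (N+2*j+2)))"
    by (intro determined_by_first_conj determined_by_first_mono[OF Q])
       (auto simp: determined_by_first_def)
  show ?thesis
    unfolding N_STT_eq first_two_ahead_iff_pairs[OF assms(2)] N_def[symmetric]
    using prob_determined_and_next_pair(2)[OF split] prob_determined_and_pairs_split[OF Q \<open>even N\<close>, of "L-1"] \<open>even N\<close>
    by (simp add: add.assoc conj_assoc mult.assoc)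
qed

text \<open>
  Both branches of \<open>prob_N_STT\<close> are instances of one fact: the law of the STT is the same in
  conjunction with any event determined by the first \<open>2K-2\<close> points, here the sure event and the event
  that the STT is reached.
\<close>

lemma prob_N_STT_even:
  assumes "K \<ge> 1" "L \<ge> 1"
  shows "prob_N_STT M X K (2*L) =
      (pA * pB + (1-pA) * (1-pB)) ^ (L-1) * (pA * (1-pB) + (1-pA) * pB)"
proof -
  have "determined_by_first (2*(K-1)) (\<lambda>_. True)" by (simp add: determined_by_first_def)
  from prob_determined_and_N_STT[OF this assms(2)]
    prob_determined_and_N_STT[OF determined_by_first_reaches[OF assms(1)] assms(2)]
  show ?thesis
    by (simp add: prob_N_STT_def theta_tied_def cond_prob_def prob_space conj_commute)
qed

lemma prob_N_ST_early:
  assumes "K \<ge> 1" "n \<le> 2*(K-1)"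
  shows "\<P>(\<omega> in M. N_ST K (\<lambda>i. X i \<omega>) = enat n) =
    (theta_ST M X K K (n-K) + theta_ST M X K (n-K) K) * of_bool (K \<le> n)"
proof (cases "K \<le> n")
  case True
  have ends: "ends_with K w a b \<longleftrightarrow> N_ST K w = enat n \<and> score_A w n = a \<and> score_B w n = b"
    if "a + b = n" for w a b
    using that score_add by (auto simp: ends_with_def)
  have meas: "{\<omega> \<in> space M. ends_with K (\<lambda>i. X i \<omega>) a b} \<in> events" if "a + b = n" for a b
    unfolding ends[OF that] 
    by (rule sets_determined_event[OF determined_by_first_N_ST[where R = "\<lambda>x y. x = a \<and> y = b"]])
  have "{\<omega> \<in> space M. N_ST K (\<lambda>i. X i \<omega>) = enat n} =
      {\<omega> \<in> space M. ends_with K (\<lambda>i. X i \<omega>) K (n-K)} \<union> {\<omega> \<in> space M. ends_with K (\<lambda>i. X i \<omega>) (n-K) K}"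
    using N_ST_early_iff[OF assms] True by auto
  moreover have "n - K \<noteq> K" using assms by linarith
  then have "{\<omega> \<in> space M. ends_with K (\<lambda>i. X i \<omega>) K (n-K)} \<inter> {\<omega> \<in> space M. ends_with K (\<lambda>i. X i \<omega>) (n-K) K} = {}"
    by (auto simp: ends_with_def)
  ultimately show ?thesis
    using True by (simp add: theta_ST_def finite_measure_Union meas)
next
  case False
  then show ?thesis using N_ST_early_iff[OF assms] by simp
qed

lemma prob_N_ST_late:
  assumes "K \<ge> 1" "n > 2*(K-1)"
  shows "\<P>(\<omega> in M. N_ST K (\<lambda>i. X i \<omega>) = enat n) =
    theta_tied M X K * prob_N_STT M X K (n - 2*(K-1)) * of_bool (even n)"
proof (cases "even n")
  case False
  then have "odd (n - 2*(K-1))" using assms(2) by simp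
  then have "N_STT K w \<noteq> enat (n - 2*(K-1))" for w
    using first_two_ahead_even by (metis N_STT_eq)
  then show ?thesis using False by (simp add: N_ST_late_iff[OF assms])
next
  case True
  then have "even (n - 2*(K-1))" "n - 2*(K-1) > 0" using assms(2) by auto
  then obtain L where L: "n - 2*(K-1) = 2*L" "L \<ge> 1" by (elim evenE) auto
  show ?thesis
    unfolding N_ST_late_iff[OF assms] L(1) prob_N_STT_even[OF assms(1) L(2)]
      prob_determined_and_N_STT[OF determined_by_first_reaches[OF assms(1)] L(2)]
    using True by (simp add: theta_tied_def)
qed

end

theorem theorem3p5:
  fixes M :: "'w measure" and X :: "nat \<Rightarrow> 'w \<Rightarrow> bool"
    and K :: nat and pA pB qA qB :: real
  assumes "K \<ge> 1"
    and "pA \<in> {0..1}" and "pB \<in> {0..1}"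
    and "qA = 1 - pA" and "qB = 1 - pB"
    and "tiebreak_points M X pA pB"
  shows "(\<forall>n\<ge>1. \<P>(\<omega> in M. N_ST K (\<lambda>i. X i \<omega>) = enat n) =
            (theta_ST M X K K (n - K) + theta_ST M X K (n - K) K)
              * of_bool (K \<le> n \<and> n \<le> 2 * (K - 1))
            + (theta_tied M X K * prob_N_STT M X K (n - (2 * K - 2)))
              * of_bool (n \<ge> 2 * K \<and> even n))
       \<and> (\<forall>L\<ge>1. prob_N_STT M X K (2 * L) =
            (pA * pB + qA * qB) ^ (L - 1) * (pA * qB + qA * pB))"
proof -
  interpret tiebreak_points M X pA pB by fact
  have "\<P>(\<omega> in M. N_ST K (\<lambda>i. X i \<omega>) = enat n) =
      (theta_ST M X K K (n - K) + theta_ST M X K (n - K) K) * of_bool (K \<le> n \<and> n \<le> 2 * (K - 1))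
      + (theta_tied M X K * prob_N_STT M X K (n - (2 * K - 2))) * of_bool (n \<ge> 2 * K \<and> even n)" for n
  proof (cases "n \<le> 2*(K-1)")
    case True
    then have "\<not> n \<ge> 2*K" using assms(1) by linarith
    with True show ?thesis using prob_N_ST_early[OF assms(1) True] by simp
  next
    case False
    \<comment> \<open>The only \<open>n\<close> strictly between \<open>2K-2\<close> and \<open>2K\<close> is odd.\<close>
    moreover from this have "n \<ge> 2*K" if even: "even n"
    proof -
      obtain j where "n = 2*j" using even by (rule evenE)
      with \<open>\<not> n \<le> 2*(K-1)\<close> show ?thesis by auto
    qed
    ultimately show ?thesis
      using prob_N_ST_late[OF assms(1), of n] by (cases "even n") (simp_all add: right_diff_distrib')
  qed
  then show ?thesis using prob_N_STT_even[OF assms(1)] assms(4,5) by simp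
qed

end
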